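(* Let $k$ be a positive integer and $n\ge 2k$. Let $\mathcal{A}_1=2^{[k]}\setminus\{\emptyset\}$, $\mathcal{A}_2=2^{\{k+1,\dots,2k-1\}}\setminus\{\emptyset\}$, $\mathcal{A}_{1,2}=\{[k]\cup A: A\in\mathcal{A}_2\}$, and \[\mathcal{F}=\mathcal{F}_k=\{\emptyset,[n]\}\cup(\mathcal{A}_1\cup\mathcal{A}_2\cup\mathcal{A}_{1,2})\cup(\mathcal{A}_1\cup\mathcal{A}_2\cup\mathcal{A}_{1,2})^c,\] where $\mathcal{H}^c=\{[n]\setminus H:H\in\mathcal{H}\}$. Then $\mathcal{F}$ contains no induced copy of $2C_k+C_1$, and there is a constant $c$ depending only on $k$ such that for all but at most $c$ sets $G\in 2^{[n]}\setminus\mathcal{F}$, the family $\mathcal{F}\cup\{G\}$ contains an induced copy of $2C_k+C_1$.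
   Context: $[n]=\{1,\dots,n\}$. For a poset $P=(P,\leqslant)$, a family $\mathcal{G}$ of sets is an induced copy of $P$ if there is a bijection $b:P\to\mathcal{G}$ with $p\leqslant q$ if and only if $b(p)\subseteq b(q)$. $C_k$ denotes the $k$-element chain; $2C_k+C_1$ is the poset consisting of two $k$-element chains and one single element, pairwise incomparable.
   Formalization: The second claim (existence of c) is stated only for k ≥ 2: for k = 1, F = {∅,[n],{1},[n]\{1}} and every G contains {1} or lies in [n]\{1}, so no G completes a copy and all 2^n − 4 sets are exceptional. The first claim is for all k ≥ 1. *)

theory Defs
  imports Main
begin

text \<open>A poset is given by its reflexive order relation \<^term>\<open>r\<close>; its underlying set is
  \<^term>\<open>Field r\<close>.\<close>

definition induced_copy :: "'a rel \<Rightarrow> 'b set set \<Rightarrow> bool" where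
  "induced_copy r \<G> \<longleftrightarrow>
     (\<exists>b. bij_betw b (Field r) \<G> \<and>
          (\<forall>p\<in>Field r. \<forall>q\<in>Field r. (p, q) \<in> r \<longleftrightarrow> b p \<subseteq> b q))"

definition contains_induced_copy :: "'b set set \<Rightarrow> 'a rel \<Rightarrow> bool" where
  "contains_induced_copy \<F> r \<longleftrightarrow> (\<exists>\<G>\<subseteq>\<F>. induced_copy r \<G>)"

definition chain_poset :: "nat \<Rightarrow> nat rel" where
  "chain_poset k = {(i, j). 1 \<le> i \<and> i \<le> j \<and> j \<le> k}"

text \<open>Disjoint union of posets, elements of different summands being incomparable.\<close>

definition poset_sum :: "'a rel \<Rightarrow> 'b rel \<Rightarrow> ('a + 'b) rel" where
  "poset_sum r s = map_prod Inl Inl ` r \<union> map_prod Inr Inr ` s"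

definition two_chains_plus_point :: "nat \<Rightarrow> ((nat + nat) + nat) rel" where
  "two_chains_plus_point k =
     poset_sum (poset_sum (chain_poset k) (chain_poset k)) (chain_poset 1)"

definition family_A1 :: "nat \<Rightarrow> nat set set" where
  "family_A1 k = Pow {1..k} - {{}}"

text \<open>For \<^term>\<open>k = (1::nat)\<close> the next family is empty. Then no \<open>family_F 1 n \<union> {G}\<close>
  has three pairwise incomparable members: each subset of \<^term>\<open>{1..n}\<close> either contains
  \<^term>\<open>{1}\<close> or is contained in \<^term>\<open>{1..n} - {1}\<close>.\<close>

definition family_A2 :: "nat \<Rightarrow> nat set set" where
  "family_A2 k = Pow {k + 1..2 * k - 1} - {{}}"

definition family_A12 :: "nat \<Rightarrow> nat set set" where
  "family_A12 k = {{1..k} \<union> A | A. A \<in> family_A2 k}"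

definition compl_family :: "nat \<Rightarrow> nat set set \<Rightarrow> nat set set" where
  "compl_family n \<H> = {{1..n} - H | H. H \<in> \<H>}"

definition family_F :: "nat \<Rightarrow> nat \<Rightarrow> nat set set" where
  "family_F k n =
     {{}, {1..n}} \<union> (family_A1 k \<union> family_A2 k \<union> family_A12 k)
       \<union> compl_family n (family_A1 k \<union> family_A2 k \<union> family_A12 k)"

lemma Field_chain_poset: "Field (chain_poset k) = {1..k}"
  by (force simp: chain_poset_def Field_def)

lemma Linear_order_chain_poset: "Linear_order (chain_poset k)"
  unfolding Field_chain_poset
  by (auto simp: chain_poset_def linear_order_on_def partial_order_on_def preorder_on_def
      refl_on_def trans_def antisym_def total_on_def)

lemma Field_poset_sum: "Field (poset_sum r s) = Field r <+> Field s"
  by (force simp: poset_sum_def Field_def)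

lemma poset_sum_iff [simp]:
  "(Inl x, Inl x') \<in> poset_sum r s \<longleftrightarrow> (x, x') \<in> r"
  "(Inr y, Inr y') \<in> poset_sum r s \<longleftrightarrow> (y, y') \<in> s"
  "(Inl x, Inr y) \<notin> poset_sum r s"
  "(Inr y, Inl x) \<notin> poset_sum r s"
  by (auto simp: poset_sum_def)

end

theory Submission
  imports Defs "HOL-Library.Disjoint_Sets"
begin

text \<open>
  Split the ground set \<open>N\<close> into \<open>X = {1..k}\<close>, \<open>Y = {k+1..2k-1}\<close> and \<open>Z = {2k..n}\<close>. The family is
  the union of two Boolean algebras of subsets of \<open>N\<close> with \<open>k + 1\<close> atoms each: the atoms of the
  first are \<open>Y \<union> Z\<close> and the singletons of \<open>X\<close>, those of the second are \<open>X\<close>, \<open>Z\<close> and the singletons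
  of \<open>Y\<close>. That it contains no copy of the poset only uses that some atom \<open>W\<close> of one algebra is the
  complement of an atom of the other.

  By counting atoms below its members, a \<open>k\<close>-chain in such an algebra that avoids \<open>{}\<close> and \<open>N\<close>
  contains an atom and the complement of an atom. If one of the chains of a copy had members
  \<open>S \<subseteq> W \<subseteq> T\<close>, then the other chain and the isolated point would be incomparable to \<open>W\<close>, hence
  comparable to \<open>N - W\<close>, all on the same side of it, so that \<open>N - W\<close> would belong to the other
  chain and be comparable to the point. Therefore each chain lies in one of the algebras, and
  contains neither \<open>W\<close> nor \<open>N - W\<close>. For chains in different algebras, an atom in one of them is then
  contained in the complement of an atom in the other. For chains \<open>C\<close> and \<open>D\<close> in the same algebra,
  atoms \<open>p \<in> C\<close> and \<open>q\<close> with \<open>N - q \<in> D\<close> coincide; the isolated point splits this atom, and no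
  member of either algebra does.

  Conversely, every set \<open>G\<close> that splits \<open>Z\<close> completes a copy. If \<open>G\<close> splits \<open>X\<close>, it is the isolated
  point next to maximal chains from \<open>X\<close> to \<open>X \<union> Y\<close> and from \<open>Z\<close> to \<open>Z \<union> Y\<close>. If \<open>G\<close> is disjoint
  from \<open>X\<close>, one chain consists of subsets of \<open>X\<close>, and \<open>G\<close> belongs to the other one, which lies in
  \<open>Y \<union> Z\<close>. The case \<open>X \<subseteq> G\<close> follows by taking complements.
\<close>

section \<open>Chains and incomparable sets\<close>

definition incomparable :: "'a set \<Rightarrow> 'a set \<Rightarrow> bool" where
  "incomparable S T \<longleftrightarrow> \<not> S \<subseteq> T \<and> \<not> T \<subseteq> S"

lemma incomparable_sym: "incomparable S T \<Longrightarrow> incomparable T S"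
  by (simp add: incomparable_def)

lemma incomparable_Diff:
  "incomparable S T \<Longrightarrow> S \<subseteq> N \<Longrightarrow> T \<subseteq> N \<Longrightarrow> incomparable (N - S) (N - T)"
  unfolding incomparable_def by blast

lemma induced_copy_poset_sumE:
  assumes "induced_copy (poset_sum r s) \<G>"
  obtains \<A> \<B> where "\<G> = \<A> \<union> \<B>" "induced_copy r \<A>" "induced_copy s \<B>"
    "\<forall>S\<in>\<A>. \<forall>T\<in>\<B>. incomparable S T"
proof -
  from assms obtain b where bij: "bij_betw b (Field r <+> Field s) \<G>"
    and ord: "\<And>p q. p \<in> Field r <+> Field s \<Longrightarrow> q \<in> Field r <+> Field s \<Longrightarrow>
      (p, q) \<in> poset_sum r s \<longleftrightarrow> b p \<subseteq> b q"
    unfolding induced_copy_def Field_poset_sum by blast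
  have "inj_on (b \<circ> Inl) (Field r)" "inj_on (b \<circ> Inr) (Field s)"
    using bij by (auto simp: bij_betw_def inj_on_def)
  moreover have "(x, y) \<in> r \<longleftrightarrow> b (Inl x) \<subseteq> b (Inl y)" if "x \<in> Field r" "y \<in> Field r" for x y
    using ord[OF InlI[OF that(1)] InlI[OF that(2)]] by simp
  moreover have "(x, y) \<in> s \<longleftrightarrow> b (Inr x) \<subseteq> b (Inr y)" if "x \<in> Field s" "y \<in> Field s" for x y
    using ord[OF InrI[OF that(1)] InrI[OF that(2)]] by simp
  ultimately have "induced_copy r ((b \<circ> Inl) ` Field r)" "induced_copy s ((b \<circ> Inr) ` Field s)"
    unfolding induced_copy_def
    by (simp_all only: bij_betw_def) (metis comp_apply)+
  moreover have "\<G> = (b \<circ> Inl) ` Field r \<union> (b \<circ> Inr) ` Field s"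
    using bij by (auto simp: bij_betw_def)
  moreover have "incomparable (b (Inl x)) (b (Inr y))" if "x \<in> Field r" "y \<in> Field s" for x y
    using ord[OF InlI[OF that(1)] InrI[OF that(2)]] ord[OF InrI[OF that(2)] InlI[OF that(1)]]
    by (simp add: incomparable_def)
  then have "\<forall>S\<in>(b \<circ> Inl) ` Field r. \<forall>T\<in>(b \<circ> Inr) ` Field s. incomparable S T"
    by simp
  ultimately show ?thesis
    using that by blast
qed

lemma induced_copy_poset_sumI:
  assumes "induced_copy r \<A>" "induced_copy s \<B>"
    and inc: "\<And>S T. S \<in> \<A> \<Longrightarrow> T \<in> \<B> \<Longrightarrow> incomparable S T"
  shows "induced_copy (poset_sum r s) (\<A> \<union> \<B>)"
proof -
  from assms obtain f g
    where f: "bij_betw f (Field r) \<A>" "\<forall>p\<in>Field r. \<forall>q\<in>Field r. (p, q) \<in> r \<longleftrightarrow> f p \<subseteq> f q"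
      and g: "bij_betw g (Field s) \<B>" "\<forall>p\<in>Field s. \<forall>q\<in>Field s. (p, q) \<in> s \<longleftrightarrow> g p \<subseteq> g q"
    unfolding induced_copy_def by blast
  have fg_incomparable: "incomparable (f x) (g y)" if "x \<in> Field r" "y \<in> Field s" for x y
    using that f(1) g(1) inc by (simp add: bij_betw_apply)
  then have neq: "f x \<noteq> g y" "g y \<noteq> f x" if "x \<in> Field r" "y \<in> Field s" for x y
    using that by (auto simp: incomparable_def)
  have "inj_on (case_sum f g) (Field r <+> Field s)"
  proof (rule inj_onI)
    fix p q
    assume "p \<in> Field r <+> Field s" "q \<in> Field r <+> Field s" "case_sum f g p = case_sum f g q"
    then show "p = q"
      using inj_onD[OF bij_betw_imp_inj_on[OF f(1)]] inj_onD[OF bij_betw_imp_inj_on[OF g(1)]]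
      by (elim PlusE) (auto simp: neq)
  qed
  moreover have "case_sum f g ` (Field r <+> Field s) = \<A> \<union> \<B>"
    using bij_betw_imp_surj_on[OF f(1)] bij_betw_imp_surj_on[OF g(1)]
    by (simp add: Plus_def image_Un image_image)
  moreover have "(p, q) \<in> poset_sum r s \<longleftrightarrow> case_sum f g p \<subseteq> case_sum f g q"
    if "p \<in> Field r <+> Field s" "q \<in> Field r <+> Field s" for p q
    using that f(2) g(2) fg_incomparable by (elim PlusE) (simp_all add: incomparable_def)
  ultimately show ?thesis
    unfolding induced_copy_def Field_poset_sum bij_betw_def
    by (intro exI[of _ "case_sum f g"]) simp
qed

definition k_chain :: "nat \<Rightarrow> 'a set set \<Rightarrow> bool" where
  "k_chain k C \<longleftrightarrow> finite C \<and> card C = k \<and> chain_subset C"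

lemma k_chain_comparable: "k_chain k C \<Longrightarrow> S \<in> C \<Longrightarrow> T \<in> C \<Longrightarrow> S \<subseteq> T \<or> T \<subseteq> S"
  by (simp add: k_chain_def chain_subset_def)

lemma k_chain_nonempty: "k_chain k C \<Longrightarrow> k \<ge> 1 \<Longrightarrow> C \<noteq> {}"
  by (auto simp: k_chain_def)

lemma k_chain_image_Diff:
  assumes "k_chain k C" "C \<subseteq> Pow N"
  shows "k_chain k ((-) N ` C)"
proof -
  have "inj_on ((-) N) C"
    using assms(2) by (intro inj_onI) blast
  moreover have "chain_subset ((-) N ` C)"
    using assms(1) unfolding k_chain_def chain_subset_def by blast
  ultimately show ?thesis
    using assms(1) by (simp add: k_chain_def card_image)
qed

lemma k_chain_1_iff: "k_chain 1 C \<longleftrightarrow> (\<exists>S. C = {S})"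
  by (auto simp: k_chain_def chain_subset_def card_1_singleton_iff)

lemma k_chain_singleton: "k_chain 1 {S}"
  by (simp only: k_chain_1_iff) blast

lemma k_chain_Un:
  assumes "k_chain i C" "k_chain j D" "\<And>S T. S \<in> C \<Longrightarrow> T \<in> D \<Longrightarrow> S \<subset> T"
  shows "k_chain (i + j) (C \<union> D)"
proof -
  have "C \<inter> D = {}"
    using assms(3) by blast
  moreover have "chain_subset (C \<union> D)"
    using assms unfolding k_chain_def chain_subset_def by blast
  ultimately show ?thesis
    using assms(1,2) by (simp add: k_chain_def card_Un_disjoint)
qed

lemma strict_mono_on_chain_le_iff:
  fixes h :: "'a set \<Rightarrow> 'b :: order"
  assumes "chain_subset C" "strict_mono_on C h" "S \<in> C" "T \<in> C"
  shows "h S \<le> h T \<longleftrightarrow> S \<subseteq> T"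
proof (cases "T \<subset> S")
  case True
  then show ?thesis
    using strict_mono_onD[OF assms(2,4,3)] by auto
next
  case False
  then have "S \<subset> T \<or> S = T"
    using assms(1,3,4) unfolding chain_subset_def by blast
  then show ?thesis
    using strict_mono_onD[OF assms(2-4)] by (fastforce dest: less_imp_le)
qed

lemma k_chain_bij_betw_rank:
  assumes "k_chain k C" "strict_mono_on C h" "h ` C \<subseteq> {1..k}"
  shows "bij_betw h C {1..k}"
proof -
  have le_iff: "h S \<le> h T \<longleftrightarrow> S \<subseteq> T" if "S \<in> C" "T \<in> C" for S T
    using strict_mono_on_chain_le_iff assms(1,2) that unfolding k_chain_def by blast
  have inj: "inj_on h C"
    by (rule inj_onI) (metis le_iff order_refl subset_antisym)
  then have "h ` C = {1..k}"
    using assms(1,3) by (intro card_subset_eq) (simp_all add: k_chain_def card_image)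
  with inj show ?thesis
    by (simp add: bij_betw_def)
qed

lemma k_chain_rankE:
  assumes "k_chain k C"
  obtains h where "bij_betw h C {1..k}" "\<And>S T. S \<in> C \<Longrightarrow> T \<in> C \<Longrightarrow> h S \<le> h T \<longleftrightarrow> S \<subseteq> T"
proof
  define h where "h S = card {T \<in> C. T \<subseteq> S}" for S
  have fin: "finite C" and chain: "chain_subset C" and card: "card C = k"
    using assms by (auto simp: k_chain_def)
  have mono: "strict_mono_on C h"
    unfolding h_def using fin by (intro strict_mono_onI psubset_card_mono) auto
  show "h S \<le> h T \<longleftrightarrow> S \<subseteq> T" if "S \<in> C" "T \<in> C" for S T
    using strict_mono_on_chain_le_iff[OF chain mono that] .
  have "h S \<in> {1..k}" if "S \<in> C" for S
  proof -
    have "h S > 0" "h S \<le> card C"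
      unfolding h_def using that fin by (auto simp: card_gt_0_iff intro!: card_mono)
    then show ?thesis
      using card by simp
  qed
  then show "bij_betw h C {1..k}"
    using k_chain_bij_betw_rank[OF assms mono] by blast
qed

lemma induced_copy_chain_poset_iff: "induced_copy (chain_poset k) C \<longleftrightarrow> k_chain k C"
proof
  assume "induced_copy (chain_poset k) C"
  then obtain f where f: "bij_betw f {1..k} C"
    and ord: "\<forall>i\<in>{1..k}. \<forall>j\<in>{1..k}. (i, j) \<in> chain_poset k \<longleftrightarrow> f i \<subseteq> f j"
    unfolding induced_copy_def Field_chain_poset by blast
  have "f i \<subseteq> f j \<longleftrightarrow> i \<le> j" if "i \<in> {1..k}" "j \<in> {1..k}" for i j
    using bspec[OF bspec[OF ord that(1)] that(2)] that by (simp add: chain_poset_def)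
  then have "chain_subset C"
    unfolding chain_subset_def bij_betw_imp_surj_on[OF f, symmetric] by (metis imageE nle_le)
  then show "k_chain k C"
    using bij_betw_finite[OF f] bij_betw_same_card[OF f] by (simp add: k_chain_def)
next
  assume "k_chain k C"
  then obtain h where h: "bij_betw h C {1..k}"
    and le_iff: "\<And>S T. S \<in> C \<Longrightarrow> T \<in> C \<Longrightarrow> h S \<le> h T \<longleftrightarrow> S \<subseteq> T"
    using k_chain_rankE by blast
  let ?f = "the_inv_into C h"
  have f: "bij_betw ?f {1..k} C"
    by (rule bij_betw_the_inv_into[OF h])
  moreover have "?f i \<subseteq> ?f j \<longleftrightarrow> i \<le> j" if "i \<in> {1..k}" "j \<in> {1..k}" for i j
    using le_iff[of "?f i" "?f j"] that f h
    by (simp add: f_the_inv_into_f_bij_betw bij_betw_apply)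
  ultimately show "induced_copy (chain_poset k) C"
    unfolding induced_copy_def Field_chain_poset
    by (intro exI[of _ ?f]) (simp add: chain_poset_def)
qed

definition two_chains_and_point ::
  "nat \<Rightarrow> 'a set set \<Rightarrow> 'a set set \<Rightarrow> 'a set set \<Rightarrow> 'a set \<Rightarrow> bool" where
  "two_chains_and_point k \<F> C D e \<longleftrightarrow>
     insert e (C \<union> D) \<subseteq> \<F> \<and> k_chain k C \<and> k_chain k D \<and>
     (\<forall>S\<in>C. \<forall>T\<in>D. incomparable S T) \<and> (\<forall>S\<in>C \<union> D. incomparable S e)"

lemma two_chains_and_pointD:
  assumes "two_chains_and_point k \<F> C D e"
  shows "C \<subseteq> \<F>" "D \<subseteq> \<F>" "e \<in> \<F>" "k_chain k C" "k_chain k D"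
    "\<And>S T. S \<in> C \<Longrightarrow> T \<in> D \<Longrightarrow> incomparable S T"
    "\<And>S. S \<in> C \<Longrightarrow> incomparable S e" "\<And>S. S \<in> D \<Longrightarrow> incomparable S e"
  using assms unfolding two_chains_and_point_def by blast+

lemma two_chains_and_point_swap:
  "two_chains_and_point k \<F> C D e \<Longrightarrow> two_chains_and_point k \<F> D C e"
  unfolding two_chains_and_point_def by (auto intro: incomparable_sym)

lemma two_chains_and_point_image_Diff:
  assumes "two_chains_and_point k \<F> C D e" "\<F> \<subseteq> Pow N"
  shows "two_chains_and_point k ((-) N ` \<F>) ((-) N ` C) ((-) N ` D) (N - e)"
  using assms unfolding two_chains_and_point_def
  by (auto intro!: k_chain_image_Diff incomparable_Diff)

lemma contains_two_chains_plus_point_iff: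
  "contains_induced_copy \<F> (two_chains_plus_point k) \<longleftrightarrow>
     (\<exists>C D e. two_chains_and_point k \<F> C D e)" (is "_ \<longleftrightarrow> ?config")
proof
  assume "contains_induced_copy \<F> (two_chains_plus_point k)"
  then obtain \<G> where \<G>: "\<G> \<subseteq> \<F>"
    "induced_copy (poset_sum (poset_sum (chain_poset k) (chain_poset k)) (chain_poset 1)) \<G>"
    unfolding contains_induced_copy_def two_chains_plus_point_def by blast
  from \<G>(2) obtain \<A> E where AE: "\<G> = \<A> \<union> E"
    "induced_copy (poset_sum (chain_poset k) (chain_poset k)) \<A>" "induced_copy (chain_poset 1) E"
    "\<forall>S\<in>\<A>. \<forall>T\<in>E. incomparable S T"
    by (rule induced_copy_poset_sumE)
  from AE(2) obtain C D where CD: "\<A> = C \<union> D"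
    "induced_copy (chain_poset k) C" "induced_copy (chain_poset k) D"
    "\<forall>S\<in>C. \<forall>T\<in>D. incomparable S T"
    by (rule induced_copy_poset_sumE)
  from AE(3) obtain e where "E = {e}"
    unfolding induced_copy_chain_poset_iff k_chain_1_iff by blast
  then have "two_chains_and_point k \<F> C D e"
    using \<G>(1) AE(1,4) CD
    by (auto simp: two_chains_and_point_def induced_copy_chain_poset_iff)
  then show ?config by blast
next
  assume ?config
  then obtain C D e where "two_chains_and_point k \<F> C D e" by blast
  note config = two_chains_and_pointD[OF this]
  have "induced_copy (poset_sum (chain_poset k) (chain_poset k)) (C \<union> D)"
    using config(4-6) by (intro induced_copy_poset_sumI) (simp_all add: induced_copy_chain_poset_iff)
  moreover have "induced_copy (chain_poset 1) {e}"
    unfolding induced_copy_chain_poset_iff by (rule k_chain_singleton)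
  ultimately have "induced_copy (two_chains_plus_point k) (C \<union> D \<union> {e})"
    unfolding two_chains_plus_point_def
    by (rule induced_copy_poset_sumI) (use config(7,8) in auto)
  then show "contains_induced_copy \<F> (two_chains_plus_point k)"
    unfolding contains_induced_copy_def using config(1-3)
    by (intro exI[of _ "C \<union> D \<union> {e}"] conjI) simp_all
qed

section \<open>Chains in a finite Boolean algebra of sets\<close>

definition splits :: "'a set \<Rightarrow> 'a set \<Rightarrow> bool" where
  "splits S B \<longleftrightarrow> S \<inter> B \<noteq> {} \<and> \<not> B \<subseteq> S"

definition block_unions :: "'a set set \<Rightarrow> 'a set set" where
  "block_unions P = Union ` Pow P"

lemma partition_on_block_eqI:
  "partition_on N P \<Longrightarrow> p \<in> P \<Longrightarrow> q \<in> P \<Longrightarrow> p \<inter> q \<noteq> {} \<Longrightarrow> p = q"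
  using partition_onD2 disjointD by metis

definition blocks_below :: "'a set set \<Rightarrow> 'a set \<Rightarrow> 'a set set" where
  "blocks_below P S = {p \<in> P. p \<subseteq> S}"

lemma Union_blocks_below: "S \<in> block_unions P \<Longrightarrow> \<Union>(blocks_below P S) = S"
  by (auto simp: block_unions_def blocks_below_def)

lemma block_unions_iff:
  assumes "partition_on N P"
  shows "S \<in> block_unions P \<longleftrightarrow> S \<subseteq> N \<and> (\<forall>p\<in>P. \<not> splits S p)"
proof
  assume "S \<in> block_unions P"
  then obtain A where A: "A \<subseteq> P" "S = \<Union>A"
    by (auto simp: block_unions_def)
  show "S \<subseteq> N \<and> (\<forall>p\<in>P. \<not> splits S p)"
  proof (intro conjI ballI)
    show "S \<subseteq> N"
      using A partition_onD1[OF assms] by auto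
    fix p assume "p \<in> P"
    have "p \<in> A" if meet: "S \<inter> p \<noteq> {}"
    proof -
      obtain q where "q \<in> A" "p \<inter> q \<noteq> {}"
        using meet A(2) by blast
      then show ?thesis
        using A(1) \<open>p \<in> P\<close> partition_on_block_eqI[OF assms] by blast
    qed
    then show "\<not> splits S p"
      using A(2) by (auto simp: splits_def)
  qed
next
  assume S: "S \<subseteq> N \<and> (\<forall>p\<in>P. \<not> splits S p)"
  have "S \<subseteq> \<Union>(blocks_below P S)"
  proof
    fix x assume "x \<in> S"
    then obtain p where "p \<in> P" "x \<in> p"
      using S partition_onD1[OF assms] by blast
    then show "x \<in> \<Union>(blocks_below P S)"
      using S \<open>x \<in> S\<close> by (auto simp: splits_def blocks_below_def)
  qed
  then have "S = \<Union>(blocks_below P S)" "blocks_below P S \<subseteq> P"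
    unfolding blocks_below_def by blast+
  then show "S \<in> block_unions P"
    unfolding block_unions_def by blast
qed

lemma strict_mono_on_card_blocks_below:
  assumes "finite P"
  shows "strict_mono_on (block_unions P) (\<lambda>S. card (blocks_below P S))"
proof (rule strict_mono_onI)
  fix S T assume S: "S \<in> block_unions P" and T: "T \<in> block_unions P" and "S \<subset> T"
  then have "blocks_below P S \<noteq> blocks_below P T"
    using Union_blocks_below[OF S] Union_blocks_below[OF T] by (metis less_irrefl)
  with \<open>S \<subset> T\<close> have "blocks_below P S \<subset> blocks_below P T"
    by (auto simp: blocks_below_def)
  then show "card (blocks_below P S) < card (blocks_below P T)"
    using assms by (intro psubset_card_mono) (simp_all add: blocks_below_def)
qed

lemma k_chain_contains_block:
  assumes part: "partition_on N P" and card: "card P = Suc k" and "k \<ge> 1"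
    and C: "k_chain k C" "C \<subseteq> block_unions P" "{} \<notin> C" "N \<notin> C"
  shows "\<exists>p\<in>P. p \<in> C"
proof -
  let ?blocks = "blocks_below P"
  have fin: "finite P"
    using card by (intro card_ge_0_finite) simp
  have Union: "\<Union>(?blocks S) = S" if "S \<in> C" for S
    using that C(2) by (intro Union_blocks_below) blast
  have "card (?blocks S) \<in> {1..k}" if "S \<in> C" for S
  proof -
    have "?blocks S \<noteq> {}" "?blocks S \<noteq> P"
      using Union[OF that] that C(3,4) partition_onD1[OF part] by auto
    moreover have "?blocks S \<subseteq> P"
      by (auto simp: blocks_below_def)
    ultimately have "card (?blocks S) > 0" "card (?blocks S) < card P"
      using fin by (auto simp: card_gt_0_iff intro: finite_subset psubset_card_mono)
    then show ?thesis
      using card by simp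
  qed
  moreover have "strict_mono_on C (\<lambda>S. card (?blocks S))"
    using strict_mono_on_card_blocks_below[OF fin] C(2) by (rule monotone_on_subset)
  ultimately have "(\<lambda>S. card (?blocks S)) ` C = {1..k}"
    by (intro bij_betw_imp_surj_on k_chain_bij_betw_rank[OF C(1)] image_subsetI)
  then have "1 \<in> (\<lambda>S. card (?blocks S)) ` C"
    using \<open>k \<ge> 1\<close> by simp
  then obtain S where S: "S \<in> C" "card (?blocks S) = 1"
    by (elim imageE) simp
  then obtain p where p: "?blocks S = {p}"
    using card_1_singletonE by blast
  then have "p = S"
    using Union[OF S(1)] by simp
  moreover have "p \<in> P"
    using p unfolding blocks_below_def by blast
  ultimately show ?thesis
    using S(1) by blast
qed

lemma Diff_block_unions:
  assumes "partition_on N P" "S \<in> block_unions P"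
  shows "N - S \<in> block_unions P"
proof -
  have "p \<subseteq> N" if "p \<in> P" for p
    using that partition_onD1[OF assms(1)] by blast
  then show ?thesis
    using assms(2) unfolding block_unions_iff[OF assms(1)] splits_def by blast
qed

lemma k_chain_contains_block_complement:
  assumes part: "partition_on N P" and card: "card P = Suc k" and "k \<ge> 1"
    and C: "k_chain k C" "C \<subseteq> block_unions P" "{} \<notin> C" "N \<notin> C"
  shows "\<exists>p\<in>P. N - p \<in> C"
proof -
  have sub: "C \<subseteq> Pow N"
    using C(2) block_unions_iff[OF part] by blast
  then have Diff_Diff: "N - (N - S) = S" if "S \<in> C" for S
    using that by blast
  have "\<exists>p\<in>P. p \<in> (-) N ` C"
  proof (rule k_chain_contains_block[OF part card \<open>k \<ge> 1\<close>])
    show "k_chain k ((-) N ` C)"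
      using C(1) sub by (rule k_chain_image_Diff)
    show "(-) N ` C \<subseteq> block_unions P"
      using C(2) Diff_block_unions[OF part] by blast
    show "{} \<notin> (-) N ` C" "N \<notin> (-) N ` C"
      using C(3,4) Diff_Diff by (metis Diff_cancel Diff_empty imageE)+
  qed
  then show ?thesis
    using Diff_Diff by (metis imageE)
qed

section \<open>Two Boolean algebras linked by complementary atoms\<close>

locale linked_partitions =
  fixes N :: "'a set" and P Q :: "'a set set" and W :: "'a set" and k :: nat
  assumes partition: "partition_on N P" "partition_on N Q"
    and card_partition: "card P = Suc k" "card Q = Suc k"
    and link: "W \<in> P" "N - W \<in> Q"
begin

abbreviation fam :: "'a set set" where
  "fam \<equiv> block_unions P \<union> block_unions Q"

lemma W_subset: "W \<subseteq> N"
  using partition_onD1[OF partition(1)] link(1) by blast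

lemma W_nonempty: "W \<noteq> {}"
  using partition_onD3[OF partition(1)] link(1) by blast

lemma W_neq_N: "W \<noteq> N"
  using partition_onD3[OF partition(2)] link(2) by auto

lemma linked_partitions_swap: "linked_partitions N Q P (N - W) k"
  using partition card_partition link W_subset by unfold_locales (simp_all add: double_diff)

lemma k_pos: "k \<ge> 1"
proof (rule ccontr)
  assume "\<not> k \<ge> 1"
  then have "card P = 1"
    using card_partition(1) by simp
  then obtain p where "P = {p}"
    by (rule card_1_singletonE)
  then show False
    using link(1) W_neq_N partition_onD1[OF partition(1)] by simp
qed

lemma fam_subset: "fam \<subseteq> Pow N"
  using block_unions_iff[OF partition(1)] block_unions_iff[OF partition(2)] by blast

lemma block_unions_P_cases:
  assumes "S \<in> block_unions P"
  obtains "W \<subseteq> S" | "S \<subseteq> N - W"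
  using assms link(1) unfolding block_unions_iff[OF partition(1)] splits_def by blast

lemma block_unions_Q_cases:
  assumes "S \<in> block_unions Q"
  obtains "N - W \<subseteq> S" | "S \<subseteq> W"
proof -
  have "S \<subseteq> N" "\<not> splits S (N - W)"
    using assms link(2) unfolding block_unions_iff[OF partition(2)] by blast+
  then show ?thesis
    using that unfolding splits_def by blast
qed

lemma block_subset_complement_W: "p \<in> P \<Longrightarrow> p \<noteq> W \<Longrightarrow> p \<subseteq> N - W"
  using partition_on_block_eqI[OF partition(1)] partition_onD1[OF partition(1)] link(1) by blast

lemma chain_member_proper:
  assumes "two_chains_and_point k fam C D e"
  shows "{} \<notin> C" "N \<notin> C"
  using two_chains_and_pointD(1,3,7)[OF assms] fam_subset by (auto simp: incomparable_def)

lemma chain_extremes: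
  assumes "two_chains_and_point k fam C D e" "C \<subseteq> block_unions P"
  shows "\<exists>p\<in>P. p \<in> C" and "\<exists>p\<in>P. N - p \<in> C"
  using k_chain_contains_block[OF partition(1) card_partition(1) k_pos]
    k_chain_contains_block_complement[OF partition(1) card_partition(1) k_pos]
    two_chains_and_pointD(4)[OF assms(1)] assms(2) chain_member_proper[OF assms(1)] by blast+

lemma W_in_chain_above:
  assumes "two_chains_and_point k fam C D e" "C \<subseteq> block_unions P" "\<And>U. U \<in> C \<Longrightarrow> W \<subseteq> U"
  shows "W \<in> C"
proof -
  obtain p where p: "p \<in> P" "p \<in> C"
    using chain_extremes(1)[OF assms(1,2)] by blast
  then have "p = W"
    using assms(3) block_subset_complement_W W_nonempty by blast
  with p show ?thesis by simp
qed

lemma complement_in_chain_below: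
  assumes "two_chains_and_point k fam C D e" "C \<subseteq> block_unions P" "\<And>U. U \<in> C \<Longrightarrow> U \<subseteq> N - W"
  shows "N - W \<in> C"
proof -
  obtain p where p: "p \<in> P" "N - p \<in> C"
    using chain_extremes(2)[OF assms(1,2)] by blast
  then have "W \<subseteq> p"
    using assms(3) W_subset by blast
  then have "p = W"
    using block_subset_complement_W[OF p(1)] W_nonempty by blast
  with p show ?thesis by simp
qed

lemma incomparable_W_cases:
  assumes "U \<in> fam" "incomparable U W"
  obtains "U \<in> block_unions P" "U \<subseteq> N - W" | "U \<in> block_unions Q" "N - W \<subseteq> U"
  using assms block_unions_P_cases block_unions_Q_cases unfolding incomparable_def by blast

lemma no_chain_across_W:
  assumes config: "two_chains_and_point k fam C D e" and S: "S \<in> C" "S \<subseteq> W" and T: "T \<in> C" "W \<subseteq> T"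
  shows False
proof -
  note configD = two_chains_and_pointD[OF config]
  note config' = two_chains_and_point_swap[OF config]
  have side_of_N_W: "U \<in> block_unions P \<and> U \<subseteq> N - W \<or> U \<in> block_unions Q \<and> N - W \<subseteq> U"
    if "U \<in> insert e D" for U
  proof -
    have "incomparable S U" "incomparable T U"
      using configD(6,7) S(1) T(1) that by blast+
    then have "incomparable U W"
      using S(2) T(2) unfolding incomparable_def by blast
    moreover have "U \<in> fam"
      using configD(2,3) that by blast
    ultimately show ?thesis
      by (elim incomparable_W_cases) simp_all
  qed
  have "N - W \<notin> D"
    using side_of_N_W[of e] configD(8) by (auto simp: incomparable_def)
  moreover from side_of_N_W[of e] consider "e \<subseteq> N - W" | "N - W \<subseteq> e" by blast
  then have "N - W \<in> D"
  proof cases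
    case 1
    then have "U \<in> block_unions P \<and> U \<subseteq> N - W" if "U \<in> D" for U
      using side_of_N_W[of U] configD(8)[OF that] that by (auto simp: incomparable_def)
    then show ?thesis
      using complement_in_chain_below[OF config'] by blast
  next
    case 2
    then have "U \<in> block_unions Q \<and> N - W \<subseteq> U" if "U \<in> D" for U
      using side_of_N_W[of U] configD(8)[OF that] that by (auto simp: incomparable_def)
    then show ?thesis
      using linked_partitions.W_in_chain_above[OF linked_partitions_swap,
          unfolded Un_commute[of "block_unions Q"], OF config'] by blast
  qed
  ultimately show False ..
qed

lemma no_chain_across_complement:
  assumes "two_chains_and_point k fam C D e" "S \<in> C" "S \<subseteq> N - W" "T \<in> C" "N - W \<subseteq> T"
  shows False
  using linked_partitions.no_chain_across_W[OF linked_partitions_swap,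
      unfolded Un_commute[of "block_unions Q"]] assms by blast

lemma chain_in_one_algebra:
  assumes config: "two_chains_and_point k fam C D e"
  shows "C \<subseteq> block_unions P \<or> C \<subseteq> block_unions Q"
proof (rule ccontr)
  assume "\<not> ?thesis"
  then obtain S T where S: "S \<in> C" "S \<in> block_unions Q" and T: "T \<in> C" "T \<in> block_unions P"
    using two_chains_and_pointD(1)[OF config] by blast
  have ne: "S \<noteq> {}" "T \<noteq> {}" "S \<noteq> N" "T \<noteq> N"
    using chain_member_proper[OF config] S(1) T(1) by metis+
  have sub: "S \<subseteq> N" "T \<subseteq> N"
    using S(2) T(2) fam_subset by blast+
  have "S \<subseteq> T \<or> T \<subseteq> S"
    using k_chain_comparable two_chains_and_pointD(4)[OF config] S(1) T(1) by blast
  then have "\<not> (S \<subseteq> W \<and> T \<subseteq> N - W)" "\<not> (N - W \<subseteq> S \<and> W \<subseteq> T)"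
    using ne sub by blast+
  then consider "S \<subseteq> W" "W \<subseteq> T" | "T \<subseteq> N - W" "N - W \<subseteq> S"
    using block_unions_P_cases[OF T(2)] block_unions_Q_cases[OF S(2)] by metis
  then show False
    using no_chain_across_W[OF config] no_chain_across_complement[OF config] S(1) T(1)
    by cases blast+
qed

lemma chain_extremes_neq_W:
  assumes config: "two_chains_and_point k fam C D e" and "C \<subseteq> block_unions P"
  obtains p q where "p \<in> P" "p \<in> C" "p \<subseteq> N - W" "q \<in> P" "N - q \<in> C" "q \<subseteq> N - W"
proof -
  have "W \<notin> C" "N - W \<notin> C"
    using no_chain_across_W[OF config] no_chain_across_complement[OF config] by blast+
  then show ?thesis
    using that chain_extremes[OF assms] block_subset_complement_W by metis
qed

lemma not_both_chains_in_P:
  assumes config: "two_chains_and_point k fam C D e"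
    and "C \<subseteq> block_unions P" "D \<subseteq> block_unions P"
  shows False
proof -
  note configD = two_chains_and_pointD[OF config]
  obtain p where p: "p \<in> P" "p \<in> C" "p \<subseteq> N - W"
    using chain_extremes_neq_W[OF config assms(2)] by metis
  obtain q where q: "q \<in> P" "N - q \<in> D"
    using chain_extremes_neq_W[OF two_chains_and_point_swap[OF config] assms(3)] by metis
  have "p = q"
    using partition_on_block_eqI[OF partition(1) p(1) q(1)] configD(6)[OF p(2) q(2)] p(3)
    by (auto simp: incomparable_def)
  then have "splits e p"
    using configD(3,7,8) p(2) q(2) fam_subset by (force simp: incomparable_def splits_def)
  then have "e \<in> block_unions Q"
    using configD(3) p(1) block_unions_iff[OF partition(1)] by blast
  then show False
    using \<open>splits e p\<close> p(3) by (elim block_unions_Q_cases) (auto simp: splits_def)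
qed

lemma not_chains_in_P_and_Q:
  assumes config: "two_chains_and_point k fam C D e"
    and "C \<subseteq> block_unions P" "D \<subseteq> block_unions Q"
  shows False
proof -
  obtain p where p: "N - p \<in> C" "p \<subseteq> N - W"
    using chain_extremes_neq_W[OF config assms(2)] by metis
  obtain q where q: "q \<in> D" "q \<subseteq> N - (N - W)"
    using linked_partitions.chain_extremes_neq_W[OF linked_partitions_swap,
        unfolded Un_commute[of "block_unions Q"], OF two_chains_and_point_swap[OF config] assms(3)] by metis
  have "q \<subseteq> N - p"
    using p(2) q(2) by blast
  then show False
    using two_chains_and_pointD(6)[OF config p(1) q(1)] by (simp add: incomparable_def)
qed

lemma no_two_chains_and_point: "\<not> two_chains_and_point k fam C D e"
proof
  assume config: "two_chains_and_point k fam C D e"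
  note config' = two_chains_and_point_swap[OF config]
  have "C \<subseteq> block_unions Q" "D \<subseteq> block_unions Q"
    using chain_in_one_algebra[OF config] chain_in_one_algebra[OF config']
      not_both_chains_in_P[OF config] not_chains_in_P_and_Q[OF config]
      not_chains_in_P_and_Q[OF config'] by blast+
  then show False
    using linked_partitions.not_both_chains_in_P[OF linked_partitions_swap,
        unfolded Un_commute[of "block_unions Q"], OF config] by blast
qed

end

section \<open>Completing a copy\<close>

lemma ex_saturated_chain:
  assumes "finite D" "A \<inter> D = {}"
  shows "\<exists>C. k_chain (Suc (card D)) C \<and> A \<in> C \<and> (\<forall>S\<in>C. A \<subseteq> S \<and> S \<subseteq> A \<union> D)"
  using assms
proof (induction D rule: finite_induct)
  case empty
  show ?case
    using k_chain_singleton[of A] by (intro exI[of _ "{A}"]) simp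
next
  case (insert x D)
  then obtain C where C: "k_chain (Suc (card D)) C" "A \<in> C" "\<forall>S\<in>C. A \<subseteq> S \<and> S \<subseteq> A \<union> D"
    by auto
  have "x \<notin> A \<union> D"
    using insert.hyps(2) insert.prems by auto
  then have "S \<subset> A \<union> insert x D" if "S \<in> C" for S
    using bspec[OF C(3) that] by blast
  then have "k_chain (Suc (card D) + 1) (C \<union> {A \<union> insert x D})"
    by (intro k_chain_Un C(1) k_chain_singleton) simp
  moreover have "\<forall>S\<in>C \<union> {A \<union> insert x D}. A \<subseteq> S \<and> S \<subseteq> A \<union> insert x D"
    using C(3) by blast
  ultimately show ?case
    using C(2) insert.hyps by (intro exI[of _ "C \<union> {A \<union> insert x D}"]) simp
qed

lemma ex_chain_of_nonempty_subsets:
  assumes "finite B"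
  shows "\<exists>C. k_chain (card B) C \<and> (\<forall>S\<in>C. S \<noteq> {} \<and> S \<subseteq> B)"
proof -
  obtain C where C: "k_chain (Suc (card B)) C" "{} \<in> C" "\<forall>S\<in>C. S \<subseteq> B"
    using ex_saturated_chain[OF assms, of "{}"] by auto
  then have "k_chain (card B) (C - {{}})"
    by (simp add: k_chain_def chain_subset_def)
  then show ?thesis
    using C(3) by (intro exI[of _ "C - {{}}"]) simp
qed

lemma ex_chain_through_splitting_set:
  assumes "finite R" "R \<inter> Z = {}" "G \<subseteq> R \<union> Z" "splits G Z"
  shows "\<exists>D. k_chain (card R + 2) D \<and> (\<forall>S\<in>D. S \<noteq> {} \<and> S \<subseteq> R \<union> Z \<and> (S = G \<or> \<not> splits S Z))"
proof -
  define B where "B = G \<inter> R"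
  have B: "B \<subseteq> R" "B \<subset> G" "G \<subset> Z \<union> B" "B \<inter> Z = {}"
    using assms(2-4) by (auto simp: B_def splits_def)
  obtain L where L: "k_chain (card B) L" "\<forall>S\<in>L. S \<noteq> {} \<and> S \<subseteq> B"
    using ex_chain_of_nonempty_subsets finite_subset[OF B(1) assms(1)] by blast
  have "(Z \<union> B) \<inter> (R - B) = {}" "Z \<union> B \<union> (R - B) = Z \<union> R"
    using assms(2) B(1) by auto
  then obtain U where U: "k_chain (Suc (card (R - B))) U" "\<forall>S\<in>U. Z \<union> B \<subseteq> S \<and> S \<subseteq> Z \<union> R"
    using ex_saturated_chain[of "R - B" "Z \<union> B"] assms(1) by auto
  have "G \<subset> S" if "S \<in> U" for S
    using that U(2) B(3) by blast
  then have "k_chain (1 + Suc (card (R - B))) ({G} \<union> U)"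
    by (intro k_chain_Un k_chain_singleton U(1)) simp
  moreover have "S \<subset> T" if "S \<in> L" "T \<in> {G} \<union> U" for S T
    using that L(2) U(2) B(2,3) by blast
  ultimately have "k_chain (card B + (1 + Suc (card (R - B)))) (L \<union> ({G} \<union> U))"
    by (rule k_chain_Un[OF L(1)])
  moreover have "card B + card (R - B) = card R"
    using B(1) assms(1) by (simp add: card_Diff_subset card_mono finite_subset)
  ultimately have "k_chain (card R + 2) (L \<union> ({G} \<union> U))"
    by (simp add: algebra_simps)
  moreover have "S \<noteq> {} \<and> S \<subseteq> R \<union> Z \<and> \<not> splits S Z" if "S \<in> L" for S
    using bspec[OF L(2) that] B(1,4) unfolding splits_def by blast
  moreover have "S \<noteq> {} \<and> S \<subseteq> R \<union> Z \<and> \<not> splits S Z" if "S \<in> U" for S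
    using bspec[OF U(2) that] B(2,3) unfolding splits_def by blast
  moreover have "G \<noteq> {} \<and> G \<subseteq> R \<union> Z"
    using assms(3) B(2) by blast
  ultimately show ?thesis
    by (intro exI[of _ "L \<union> ({G} \<union> U)"]) auto
qed

definition lower_family :: "'a set \<Rightarrow> 'a set \<Rightarrow> 'a set set" where
  "lower_family X Y = Pow X \<union> Pow Y \<union> (\<union>) X ` Pow Y"

locale three_blocks =
  fixes X Y Z :: "'a set" and k :: nat
  assumes finite_blocks: "finite X" "finite Y" "finite Z"
    and disjoint_blocks: "X \<inter> Y = {}" "X \<inter> Z = {}" "Y \<inter> Z = {}"
    and card_blocks: "card X = k" "Suc (card Y) = k"
    and Z_nonempty: "Z \<noteq> {}"
begin

definition ground :: "'a set" where
  "ground = X \<union> Y \<union> Z"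

definition X_atoms :: "'a set set" where
  "X_atoms = insert (Y \<union> Z) ((\<lambda>x. {x}) ` X)"

definition Y_atoms :: "'a set set" where
  "Y_atoms = insert X (insert Z ((\<lambda>y. {y}) ` Y))"

lemma X_nonempty: "X \<noteq> {}"
  using card_blocks by auto

sublocale linked_partitions ground X_atoms Y_atoms "Y \<union> Z" k
proof
  show "partition_on ground X_atoms" "partition_on ground Y_atoms"
    using disjoint_blocks X_nonempty Z_nonempty
    by (auto simp: partition_on_def disjoint_def X_atoms_def Y_atoms_def ground_def)
  have "Y \<union> Z \<notin> (\<lambda>x. {x}) ` X"
    using disjoint_blocks Z_nonempty by auto
  then show "card X_atoms = Suc k"
    using finite_blocks card_blocks by (simp add: X_atoms_def card_image)
  have "X \<notin> insert Z ((\<lambda>y. {y}) ` Y)" "Z \<notin> (\<lambda>y. {y}) ` Y"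
    using disjoint_blocks X_nonempty Z_nonempty by auto
  then show "card Y_atoms = Suc k"
    using finite_blocks card_blocks by (simp add: Y_atoms_def card_image)
  show "Y \<union> Z \<in> X_atoms" "ground - (Y \<union> Z) \<in> Y_atoms"
    using disjoint_blocks by (auto simp: X_atoms_def Y_atoms_def ground_def)
qed

lemma fam_iff:
  "S \<in> fam \<longleftrightarrow> S \<subseteq> ground \<and> (\<not> splits S (Y \<union> Z) \<or> \<not> splits S X \<and> \<not> splits S Z)"
  unfolding Un_iff block_unions_iff[OF partition(1)] block_unions_iff[OF partition(2)]
  by (auto simp: X_atoms_def Y_atoms_def splits_def)

lemma ground_Diff_mem_fam: "S \<in> fam \<Longrightarrow> ground - S \<in> fam"
  using Diff_block_unions partition by blast

lemma fam_image_Diff: "(-) ground ` fam = fam"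
proof
  show "(-) ground ` fam \<subseteq> fam"
    using ground_Diff_mem_fam by blast
  show "fam \<subseteq> (-) ground ` fam"
  proof
    fix S assume "S \<in> fam"
    then have "S = ground - (ground - S)" "ground - S \<in> fam"
      using fam_subset ground_Diff_mem_fam by blast+
    then show "S \<in> (-) ground ` fam" by blast
  qed
qed

lemma ex_two_chains_and_point_if_splits_X:
  assumes "splits G X" "splits G Z"
  shows "\<exists>C D. two_chains_and_point k (insert G fam) C D G"
proof -
  obtain C where C: "k_chain k C" "\<forall>S\<in>C. X \<subseteq> S \<and> S \<subseteq> X \<union> Y"
    using ex_saturated_chain[OF finite_blocks(2) disjoint_blocks(1)] card_blocks(2) by auto
  obtain D where D: "k_chain k D" "\<forall>S\<in>D. Z \<subseteq> S \<and> S \<subseteq> Z \<union> Y"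
    using ex_saturated_chain[OF finite_blocks(2), of Z] disjoint_blocks(3) card_blocks(2) by auto
  have C_mem: "S \<in> fam \<and> incomparable S G" if "S \<in> C" for S
  proof -
    have "X \<subseteq> S" "S \<subseteq> X \<union> Y" using that C(2) by auto
    then show ?thesis
      using assms disjoint_blocks unfolding fam_iff ground_def splits_def incomparable_def by blast
  qed
  have D_mem: "S \<in> fam \<and> incomparable S G" if "S \<in> D" for S
  proof -
    have "Z \<subseteq> S" "S \<subseteq> Z \<union> Y" using that D(2) by auto
    then show ?thesis
      using assms disjoint_blocks unfolding fam_iff ground_def splits_def incomparable_def by blast
  qed
  have "incomparable S T" if "S \<in> C" "T \<in> D" for S T
  proof -
    have "X \<subseteq> S" "S \<subseteq> X \<union> Y" "Z \<subseteq> T" "T \<subseteq> Z \<union> Y" using that C(2) D(2) by auto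
    then show ?thesis
      using X_nonempty Z_nonempty disjoint_blocks unfolding incomparable_def by blast
  qed
  then have "two_chains_and_point k (insert G fam) C D G"
    using C(1) D(1) C_mem D_mem by (auto simp: two_chains_and_point_def)
  then show ?thesis by blast
qed

lemma mem_fam_if_subset_X: "S \<subseteq> X \<Longrightarrow> S \<in> fam"
  using disjoint_blocks unfolding fam_iff ground_def splits_def by blast

lemma mem_fam_if_subset_YZ: "S \<subseteq> Y \<union> Z \<Longrightarrow> \<not> splits S Z \<Longrightarrow> S \<in> fam"
  using disjoint_blocks unfolding fam_iff ground_def splits_def by blast

definition chain_and_point_in_YZ :: "'a set \<Rightarrow> 'a set set \<Rightarrow> 'a set \<Rightarrow> bool" where
  "chain_and_point_in_YZ G D e \<longleftrightarrow>
     k_chain k D \<and> e \<in> fam \<and> e \<subseteq> Y \<union> Z \<and>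
     (\<forall>S\<in>D. S \<in> insert G fam \<and> S \<subseteq> Y \<union> Z \<and> incomparable S e)"

lemma ex_chain_and_point_if_not_superset_Y:
  assumes "G \<subseteq> Y \<union> Z" "splits G Z" "y \<in> Y" "y \<notin> G"
  shows "\<exists>D e. chain_and_point_in_YZ G D e"
proof -
  have "y \<notin> Z"
    using assms(3) disjoint_blocks by blast
  moreover have "G \<subseteq> Y - {y} \<union> Z"
    using assms(1,4) by blast
  ultimately obtain D where D: "k_chain (card (Y - {y}) + 2) D"
    "\<forall>S\<in>D. S \<noteq> {} \<and> S \<subseteq> Y - {y} \<union> Z \<and> (S = G \<or> \<not> splits S Z)"
    using ex_chain_through_splitting_set[of "Y - {y}" Z G] finite_blocks disjoint_blocks assms(2)
    by blast
  have "k_chain k D"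
    using D(1) card_Suc_Diff1[OF finite_blocks(2) assms(3)] card_blocks(2) by simp
  moreover have "{y} \<in> fam"
    using assms(3) \<open>y \<notin> Z\<close> by (intro mem_fam_if_subset_YZ) (auto simp: splits_def)
  moreover have "S \<in> insert G fam \<and> S \<subseteq> Y \<union> Z \<and> incomparable S {y}" if "S \<in> D" for S
  proof -
    have S: "S \<noteq> {}" "S \<subseteq> Y - {y} \<union> Z" "S = G \<or> \<not> splits S Z"
      using that D(2) by blast+
    then have "S \<subseteq> Y \<union> Z" "y \<notin> S"
      using \<open>y \<notin> Z\<close> by auto
    with S show ?thesis
      using mem_fam_if_subset_YZ by (auto simp: incomparable_def)
  qed
  ultimately have "chain_and_point_in_YZ G D {y}"
    using assms(3) by (simp add: chain_and_point_in_YZ_def)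
  then show ?thesis by blast
qed

lemma ex_chain_and_point_if_superset_Y:
  assumes "G \<subseteq> Y \<union> Z" "splits G Z" "y \<in> Y" "Y \<subseteq> G"
  shows "\<exists>D e. chain_and_point_in_YZ G D e"
proof -
  obtain L where L: "k_chain (Suc (card (Y - {y}))) L" "\<forall>S\<in>L. {y} \<subseteq> S \<and> S \<subseteq> Y"
    using ex_saturated_chain[of "Y - {y}" "{y}"] finite_blocks(2) assms(3)
    by (auto simp: insert_absorb)
  have "S \<subset> G" if "S \<in> L" for S
    using bspec[OF L(2) that] assms(2,4) disjoint_blocks(3) unfolding splits_def by blast
  then have "k_chain (Suc (card (Y - {y})) + 1) (L \<union> {G})"
    by (intro k_chain_Un L(1) k_chain_singleton) simp
  then have "k_chain k (L \<union> {G})"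
    using card_Suc_Diff1[OF finite_blocks(2) assms(3)] card_blocks(2) by simp
  moreover have "Z \<union> (Y - {y}) \<in> fam"
    by (intro mem_fam_if_subset_YZ) (auto simp: splits_def)
  moreover have "S \<in> insert G fam \<and> S \<subseteq> Y \<union> Z \<and> incomparable S (Z \<union> (Y - {y}))"
    if "S \<in> L \<union> {G}" for S
  proof -
    have "y \<in> S" "S = G \<or> S \<subseteq> Y"
      using that L(2) assms(3,4) by auto
    moreover from this have "\<not> Z \<subseteq> S"
      using assms(2) disjoint_blocks(3) Z_nonempty unfolding splits_def by blast
    moreover have "S \<in> fam" if "S \<subseteq> Y"
      using that disjoint_blocks(3) by (intro mem_fam_if_subset_YZ) (auto simp: splits_def)
    ultimately show ?thesis
      using assms(1,3) disjoint_blocks(3) unfolding incomparable_def by blast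
  qed
  ultimately have "chain_and_point_in_YZ G (L \<union> {G}) (Z \<union> (Y - {y}))"
    unfolding chain_and_point_in_YZ_def by blast
  then show ?thesis by blast
qed

lemma ex_two_chains_and_point_if_disjoint_X:
  assumes "k \<ge> 2" "G \<subseteq> Y \<union> Z" "splits G Z"
  shows "\<exists>C D e. two_chains_and_point k (insert G fam) C D e"
proof -
  obtain C where C: "k_chain k C" "\<forall>S\<in>C. S \<noteq> {} \<and> S \<subseteq> X"
    using ex_chain_of_nonempty_subsets[OF finite_blocks(1)] card_blocks(1) by auto
  obtain y where "y \<in> Y"
    using assms(1) card_blocks(2) by fastforce
  obtain D e where De: "chain_and_point_in_YZ G D e"
    using ex_chain_and_point_if_superset_Y[OF assms(2,3) \<open>y \<in> Y\<close>]
      ex_chain_and_point_if_not_superset_Y[OF assms(2,3)] by (cases "Y \<subseteq> G") blast+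
  then have D: "k_chain k D" "e \<in> fam" "e \<subseteq> Y \<union> Z" "D \<subseteq> insert G fam"
    unfolding chain_and_point_in_YZ_def by blast+
  have D_mem: "S \<subseteq> Y \<union> Z" "incomparable S e" if "S \<in> D" for S
    using De that unfolding chain_and_point_in_YZ_def by blast+
  have "D \<noteq> {}"
    using D(1) k_pos by (rule k_chain_nonempty)
  then have nonempty: "T \<noteq> {}" if "T \<in> insert e D" for T
    using that D_mem(2) by (auto simp: incomparable_def)
  have "C \<subseteq> fam"
    using C(2) mem_fam_if_subset_X by blast
  moreover have "incomparable S T" if S: "S \<in> C" and T: "T \<in> insert e D" for S T
  proof -
    have "S \<noteq> {}" "S \<subseteq> X" "T \<subseteq> Y \<union> Z"
      using C(2) D(3) D_mem(1) S T by auto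
    then show ?thesis
      using nonempty[OF T] disjoint_blocks unfolding incomparable_def by blast
  qed
  ultimately have "two_chains_and_point k (insert G fam) C D e"
    using C(1) D D_mem(2) by (auto simp: two_chains_and_point_def)
  then show ?thesis by blast
qed

lemma ex_two_chains_and_point_if_splits_Z:
  assumes "k \<ge> 2" "G \<subseteq> ground" "splits G Z"
  shows "\<exists>C D e. two_chains_and_point k (insert G fam) C D e"
proof -
  consider "splits G X" | "X \<inter> G = {}" | "X \<subseteq> G"
    unfolding splits_def by blast
  then show ?thesis
  proof cases
    case 1
    then show ?thesis
      using ex_two_chains_and_point_if_splits_X assms(3) by blast
  next
    case 2
    then have "G \<subseteq> Y \<union> Z"
      using assms(2) unfolding ground_def by blast
    then show ?thesis
      using ex_two_chains_and_point_if_disjoint_X assms(1,3) by blast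
  next
    case 3
    then have "ground - G \<subseteq> Y \<union> Z" "splits (ground - G) Z"
      using assms(2,3) unfolding ground_def splits_def by blast+
    then obtain C D e where "two_chains_and_point k (insert (ground - G) fam) C D e"
      using ex_two_chains_and_point_if_disjoint_X[OF assms(1)] by blast
    then have "two_chains_and_point k ((-) ground ` insert (ground - G) fam)
        ((-) ground ` C) ((-) ground ` D) (ground - e)"
      using fam_subset by (intro two_chains_and_point_image_Diff) simp_all
    moreover have "(-) ground ` insert (ground - G) fam = insert G fam"
      using assms(2) by (simp only: image_insert fam_image_Diff double_diff order_refl)
    ultimately show ?thesis by auto
  qed
qed

lemma no_induced_copy_fam: "\<not> contains_induced_copy fam (two_chains_plus_point k)"
  unfolding contains_two_chains_plus_point_iff using no_two_chains_and_point by blast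

lemma card_not_completing_le:
  assumes "k \<ge> 2"
  shows "card {G \<in> Pow ground - fam. \<not> contains_induced_copy (fam \<union> {G}) (two_chains_plus_point k)}
    \<le> 2 * 2 ^ card (X \<union> Y)" (is "card ?bad \<le> _")
proof -
  have "\<not> splits G Z" if "G \<in> ?bad" for G
    using that ex_two_chains_and_point_if_splits_Z[OF assms, of G]
    unfolding contains_two_chains_plus_point_iff by auto
  then have "?bad \<subseteq> {G \<in> Pow ground. \<not> splits G Z}"
    by blast
  also have "\<dots> \<subseteq> Pow (X \<union> Y) \<union> (\<union>) Z ` Pow (X \<union> Y)"
  proof
    fix G assume G: "G \<in> {G \<in> Pow ground. \<not> splits G Z}"
    then consider "G \<inter> Z = {}" | "Z \<subseteq> G"
      by (auto simp: splits_def)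
    then show "G \<in> Pow (X \<union> Y) \<union> (\<union>) Z ` Pow (X \<union> Y)"
    proof cases
      case 1
      then show ?thesis
        using G by (auto simp: ground_def)
    next
      case 2
      then have "G = Z \<union> (G - Z)" "G - Z \<in> Pow (X \<union> Y)"
        using G by (auto simp: ground_def)
      then show ?thesis by blast
    qed
  qed
  finally have "card ?bad \<le> card (Pow (X \<union> Y) \<union> (\<union>) Z ` Pow (X \<union> Y))"
    using finite_blocks by (intro card_mono) auto
  also have "\<dots> \<le> card (Pow (X \<union> Y)) + card (Pow (X \<union> Y))"
    using finite_blocks by (intro order_trans[OF card_Un_le] add_left_mono card_image_le) simp
  finally show ?thesis
    using finite_blocks by (simp add: card_Pow)
qed

lemma mem_fam_iff_if_disjoint_Z:
  assumes "S \<inter> Z = {}"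
  shows "S \<in> fam \<longleftrightarrow> S \<in> lower_family X Y"
proof
  assume "S \<in> fam"
  then have "S \<subseteq> X \<union> Y" "\<not> splits S (Y \<union> Z) \<or> \<not> splits S X"
    using assms unfolding fam_iff ground_def by blast+
  moreover have "\<not> Y \<union> Z \<subseteq> S"
    using assms Z_nonempty by blast
  ultimately consider "S \<subseteq> X" | "S \<subseteq> Y" | "S = X \<union> (S - X)" "S - X \<subseteq> Y"
    unfolding splits_def by blast
  then show "S \<in> lower_family X Y"
    unfolding lower_family_def by cases blast+
next
  assume "S \<in> lower_family X Y"
  then consider "S \<subseteq> X" | "S \<subseteq> Y" | "X \<subseteq> S" "S \<subseteq> X \<union> Y"
    unfolding lower_family_def by blast
  then show "S \<in> fam"
  proof cases
    case 1
    then show ?thesis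
      by (rule mem_fam_if_subset_X)
  next
    case 2
    then show ?thesis
      using assms by (intro mem_fam_if_subset_YZ) (auto simp: splits_def)
  next
    case 3
    then show ?thesis
      using assms unfolding fam_iff ground_def splits_def by blast
  qed
qed

lemma fam_eq_Un_image_Diff: "fam = lower_family X Y \<union> (-) ground ` lower_family X Y"
proof
  have "S \<in> fam" if "S \<in> lower_family X Y" for S
  proof -
    have "S \<inter> Z = {}"
      using that disjoint_blocks by (auto simp: lower_family_def)
    then show ?thesis
      using that mem_fam_iff_if_disjoint_Z by blast
  qed
  then show "lower_family X Y \<union> (-) ground ` lower_family X Y \<subseteq> fam"
    using ground_Diff_mem_fam by blast
  show "fam \<subseteq> lower_family X Y \<union> (-) ground ` lower_family X Y"
  proof
    fix S assume S: "S \<in> fam"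
    then have "\<not> splits S Z" "S \<subseteq> ground"
      unfolding fam_iff splits_def by blast+
    then consider "S \<inter> Z = {}" | "(ground - S) \<inter> Z = {}" "S = ground - (ground - S)"
      unfolding splits_def by blast
    then show "S \<in> lower_family X Y \<union> (-) ground ` lower_family X Y"
    proof cases
      case 1
      then show ?thesis
        using S mem_fam_iff_if_disjoint_Z by simp
    next
      case 2
      then have "ground - S \<in> lower_family X Y"
        using ground_Diff_mem_fam[OF S] mem_fam_iff_if_disjoint_Z by simp
      then show ?thesis
        using 2(2) by blast
    qed
  qed
qed

end

lemma three_blocks_intervals:
  assumes "k \<ge> 1" "n \<ge> 2 * k"
  shows "three_blocks {1..k} {k + 1..2 * k - 1} {2 * k..n} k"
  using assms by unfold_locales auto

lemma ground_intervals:
  fixes k n :: nat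
  assumes "k \<ge> 1" "n \<ge> 2 * k"
  shows "three_blocks.ground {1..k} {k + 1..2 * k - 1} {2 * k..n} = {1..n}"
  unfolding three_blocks.ground_def[OF three_blocks_intervals[OF assms]] using assms by auto

lemma family_F_eq:
  assumes "k \<ge> 1"
  shows "family_F k n = lower_family {1..k} {k + 1..2 * k - 1} \<union>
    (-) {1..n} ` lower_family {1..k} {k + 1..2 * k - 1}"
proof -
  define L where "L = family_A1 k \<union> family_A2 k \<union> family_A12 k"
  have "{1..k} \<in> family_A1 k"
    using assms(1) by (simp add: family_A1_def)
  moreover have "lower_family {1..k} {k + 1..2 * k - 1} =
      insert {} (family_A1 k) \<union> insert {} (family_A2 k) \<union> insert {1..k} (family_A12 k)"
    unfolding lower_family_def family_A1_def family_A2_def family_A12_def by auto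
  ultimately have "lower_family {1..k} {k + 1..2 * k - 1} = insert {} L"
    by (auto simp: L_def)
  moreover have "compl_family n L = (-) {1..n} ` L"
    by (auto simp: compl_family_def)
  ultimately show ?thesis
    unfolding family_F_def L_def[symmetric] by auto
qed

lemma family_F_eq_fam:
  assumes "k \<ge> 1" "n \<ge> 2 * k"
  shows "family_F k n =
    block_unions (three_blocks.X_atoms {1..k} {k + 1..2 * k - 1} {2 * k..n}) \<union>
    block_unions (three_blocks.Y_atoms {1..k} {k + 1..2 * k - 1} {2 * k..n})"
  unfolding family_F_eq[OF assms(1)] ground_intervals[OF assms, symmetric]
  by (rule three_blocks.fam_eq_Un_image_Diff[OF three_blocks_intervals[OF assms], symmetric])

theorem theorem2p3:
  fixes k :: "nat"
  assumes "k \<ge> 1"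
  shows "(\<forall>n\<ge>2 * k. \<not> contains_induced_copy (family_F k n) (two_chains_plus_point k)) \<and>
         (k \<ge> 2 \<longrightarrow>
           (\<exists>c::nat. \<forall>n\<ge>2 * k.
              card {G \<in> Pow {1..n} - family_F k n.
                      \<not> contains_induced_copy (family_F k n \<union> {G}) (two_chains_plus_point k)} \<le> c))"
proof (intro conjI impI allI exI)
  fix n assume n: "n \<ge> 2 * k"
  interpret three_blocks "{1..k}" "{k + 1..2 * k - 1}" "{2 * k..n}" k
    using assms n by (rule three_blocks_intervals)
  show "\<not> contains_induced_copy (family_F k n) (two_chains_plus_point k)"
    unfolding family_F_eq_fam[OF assms n] by (rule no_induced_copy_fam)
next
  fix n assume k: "k \<ge> 2" and n: "n \<ge> 2 * k"
  interpret three_blocks "{1..k}" "{k + 1..2 * k - 1}" "{2 * k..n}" k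
    using assms n by (rule three_blocks_intervals)
  show "card {G \<in> Pow {1..n} - family_F k n.
      \<not> contains_induced_copy (family_F k n \<union> {G}) (two_chains_plus_point k)}
    \<le> 2 * 2 ^ card ({1..k} \<union> {k + 1..2 * k - 1})"
    unfolding family_F_eq_fam[OF assms n] ground_intervals[OF assms n, symmetric]
    by (rule card_not_completing_le[OF k])
qed

end
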